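(* Let $F$ be a field and let $U,V$ be $sn\times sn$ matrices over $F$ with $UV=I_{sn}$, with block structures $U=\begin{pmatrix} A_1\\ A_2\\ \vdots\\ A_s\end{pmatrix}$ and $V=(B_1,B_2,\ldots,B_s)$, where the $A_i$ are $n\times sn$ matrices and the $B_j$ are $sn\times n$ matrices. Let $E_0,E_1,\ldots,E_s$ be $rn\times sn$ matrices, each formed by choosing $r$ of the blocks $A_1,\ldots,A_s$ and stacking them in some order. Let $$G[z]=E_0+E_1z+\cdots+E_sz^s ,$$ and suppose that $A_j\in E_0$ implies $A_j\notin E_i$ for $i\neq 0$. Then $G[z]$ is a noncatastrophic generator matrix for a convolutional $(sn,rn)$ code.
   Context: $A_j\in E_i$ means that $A_j$ occurs as one of the blocks forming $E_i$; $A_j\notin E_i$ means that it does not. A convolutional $(N,k)$ code over $F$ is the $F[z]$-submodule $\{u(z)G[z]:u(z)\in F[z]^k\}$ of $F[z]^N$ for a generator matrix $G[z]\in F[z]^{k\times N}$ of rank $k$. $G[z]$ is noncatastrophic if there is a polynomial $N\times k$ matrix $H[z]$ of rank $k$ with $G[z]H[z]=I_k$. *)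

theory Defs
  imports
    "Jordan_Normal_Form.DL_Rank"
    "Jordan_Normal_Form.Determinant"
begin

(* Blocks are numbered from 1: stack_blocks q n w A has the n x w blocks A 1, ..., A q
   from top to bottom, juxtapose_blocks q h n B has the h x n blocks B 1, ..., B q
   from left to right. *)

definition stack_blocks :: "nat \<Rightarrow> nat \<Rightarrow> nat \<Rightarrow> (nat \<Rightarrow> 'a mat) \<Rightarrow> 'a mat" where
  "stack_blocks q n w A = mat (q * n) w (\<lambda>(a, b). A (Suc (a div n)) $$ (a mod n, b))"

definition juxtapose_blocks :: "nat \<Rightarrow> nat \<Rightarrow> nat \<Rightarrow> (nat \<Rightarrow> 'a mat) \<Rightarrow> 'a mat" where
  "juxtapose_blocks q h n B = mat h (q * n) (\<lambda>(a, b). B (Suc (b div n)) $$ (a, b mod n))"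

(* E 0 + E 1 z + ... + E d z^d, for k x N matrices E i. *)
definition polynomial_matrix ::
    "nat \<Rightarrow> nat \<Rightarrow> nat \<Rightarrow> (nat \<Rightarrow> 'a :: comm_monoid_add mat) \<Rightarrow> 'a poly mat" where
  "polynomial_matrix k N d E = mat k N (\<lambda>(a, b). \<Sum>i\<le>d. monom (E i $$ (a, b)) i)"

(* The rank of a matrix over F[z] is its rank over the field of fractions F(z). *)
definition poly_mat_rank :: "'a :: field poly mat \<Rightarrow> nat" where
  "poly_mat_rank M = vec_space.rank (dim_row M) (map_mat to_fract M)"

definition generator_matrix :: "nat \<Rightarrow> nat \<Rightarrow> 'a :: field poly mat \<Rightarrow> bool" where
  "generator_matrix N k G \<longleftrightarrow> G \<in> carrier_mat k N \<and> poly_mat_rank G = k"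

(* Message words u are row vectors, so u G is computed as the transpose of G applied to u. *)
definition code_of :: "'a :: field poly mat \<Rightarrow> 'a poly vec set" where
  "code_of G = {transpose_mat G *\<^sub>v u | u. u \<in> carrier_vec (dim_row G)}"

definition convolutional_code :: "nat \<Rightarrow> nat \<Rightarrow> 'a :: field poly vec set \<Rightarrow> bool" where
  "convolutional_code N k C \<longleftrightarrow> (\<exists>G. generator_matrix N k G \<and> C = code_of G)"

definition generator_matrix_for ::
    "nat \<Rightarrow> nat \<Rightarrow> 'a :: field poly mat \<Rightarrow> 'a poly vec set \<Rightarrow> bool" where
  "generator_matrix_for N k G C \<longleftrightarrow>
     convolutional_code N k C \<and> generator_matrix N k G \<and> C = code_of G"

definition noncatastrophic :: "'a :: field poly mat \<Rightarrow> bool" where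
  "noncatastrophic G \<longleftrightarrow>
     (\<exists>H \<in> carrier_mat (dim_col G) (dim_row G).
        poly_mat_rank H = dim_row G \<and> G * H = 1\<^sub>m (dim_row G))"

end

theory Submission
  imports
    Defs
    "Subresultants.More_Homomorphisms"
begin

(* Since U V = 1, the blocks satisfy A_i B_j = I if i = j and 0 otherwise. Let H be the constant
   matrix that juxtaposes the blocks B_j in the order in which the A_j occur in E_0. Then
   E_0 H = I, while E_i H = 0 for i > 0 because E_i shares no block with E_0; hence G[z] H = I.
   This equation also gives both rank conditions. *)

context vec_space
begin

text \<open>Each vector \<open>v\<close> equals \<open>M *\<^sub>v (H *\<^sub>v v)\<close>, so the
  columns of \<open>M\<close> span the whole space, whose dimension is \<open>n\<close>.\<close>

lemma rank_right_invertible: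
  assumes M: "M \<in> carrier_mat n m" and H: "H \<in> carrier_mat m n" and MH: "M * H = 1\<^sub>m n"
  shows "rank M = n"
proof -
  have "M *\<^sub>v (H *\<^sub>v v) = v" if "v \<in> carrier_vec n" for v
    using that M H MH by (metis assoc_mult_mat_vec one_mult_mat_vec)
  moreover have "H *\<^sub>v v \<in> carrier_vec (dim_col M)" if "v \<in> carrier_vec n" for v
    using that M H by (metis carrier_matD(2) mult_mat_vec_carrier)
  ultimately have "carrier_vec n \<subseteq> col_space M"
    unfolding col_space_eq[OF M] using M by (metis (mono_tags, lifting) CollectI carrier_matD(1) subsetI)
  moreover have "col_space M \<subseteq> carrier_vec n"
    using M by (auto simp: col_space_eq[OF M])
  ultimately have "span (set (cols M)) = carrier_vec n"
    by (simp add: col_space_def)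
  then have "span_vs (set (cols M)) = V"
    by (simp add: module_vec_def)
  then show ?thesis
    by (simp add: rank_def dim_is_n)
qed

text \<open>Applying \<open>K\<close> recovers \<open>v\<close> from \<open>M *\<^sub>v v\<close>,
  so \<open>M\<close> has trivial kernel and its columns are independent.\<close>

lemma rank_left_invertible:
  assumes M: "M \<in> carrier_mat n m" and K: "K \<in> carrier_mat m n" and KM: "K * M = 1\<^sub>m m"
  shows "rank M = m"
proof (rule lin_indpt_full_rank[OF M])
  have inj: "K *\<^sub>v (M *\<^sub>v v) = v" if "v \<in> carrier_vec m" for v
    using that M K KM by (metis assoc_mult_mat_vec one_mult_mat_vec)
  \<comment> \<open>Independence is stated for the set of columns, which would hide a repeated
    column. Repetition is excluded because \<open>K\<close> sends the columns to the distinct unit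
    vectors.\<close>
  show dist: "distinct (cols M)"
  proof (unfold distinct_conv_nth, intro allI impI)
    fix i j assume ij: "i < length (cols M)" "j < length (cols M)" "i \<noteq> j"
    have *: "K *\<^sub>v col M l = unit_vec m l" if "l < m" for l
      using that M K KM by (metis carrier_matD(2) col_mult2 col_one)
    show "cols M ! i \<noteq> cols M ! j"
      using *[of i] *[of j] ij M by (auto simp: unit_vec_eq)
  qed
  show "lin_indpt (set (cols M))"
  proof
    assume "lin_dep (set (cols M))"
    then obtain v where "v \<in> carrier_vec m" "v \<noteq> 0\<^sub>v m" "M *\<^sub>v v = 0\<^sub>v n"
      using lin_depE[OF M _ dist] by blast
    with inj[of v] K show False
      by auto
  qed
qed

end

text \<open>The ring homomorphism \<open>to_fract\<close> carries the equation to the field of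
  fractions, where \<open>G\<close> has a right inverse and \<open>H\<close> a left inverse. A
  polynomial right inverse thus yields the rank conditions on both matrices.\<close>

lemma poly_mat_rank_right_inverse:
  assumes G: "G \<in> carrier_mat k N" and H: "H \<in> carrier_mat N k" and GH: "G * H = 1\<^sub>m k"
  shows "poly_mat_rank G = k" and "poly_mat_rank H = k"
proof -
  have "map_mat to_fract G * map_mat to_fract H = 1\<^sub>m k"
    using to_fract_hom.mat_hom_mult[OF G H] GH by (simp add: to_fract_hom.mat_hom_one)
  then show "poly_mat_rank G = k" "poly_mat_rank H = k"
    using G H vec_space.rank_right_invertible[of "map_mat to_fract G" k N "map_mat to_fract H"]
      vec_space.rank_left_invertible[of "map_mat to_fract H" N k "map_mat to_fract G"]
    by (auto simp: poly_mat_rank_def)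
qed

text \<open>The entries of \<open>K\<close> do not involve z, so multiplying by it acts on each
  coefficient matrix separately and mixes no powers of z.\<close>

lemma polynomial_matrix_mult_const:
  fixes E :: "nat \<Rightarrow> 'a :: comm_ring_1 mat"
  assumes E: "\<And>i. i \<le> d \<Longrightarrow> E i \<in> carrier_mat k N" and K: "K \<in> carrier_mat N m"
  shows "polynomial_matrix k N d E * map_mat (\<lambda>x. [:x:]) K
         = polynomial_matrix k m d (\<lambda>i. E i * K)"
proof (rule eq_matI)
  fix a b
  assume "a < dim_row (polynomial_matrix k m d (\<lambda>i. E i * K))"
    and "b < dim_col (polynomial_matrix k m d (\<lambda>i. E i * K))"
  then have a: "a < k" and b: "b < m"
    by (auto simp: polynomial_matrix_def)
  have EK: "(E i * K) $$ (a, b) = (\<Sum>l<N. E i $$ (a, l) * K $$ (l, b))" if "i \<le> d" for i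
    using E[OF that] K a b by (auto simp: scalar_prod_def atLeast0LessThan)
  have "(polynomial_matrix k N d E * map_mat (\<lambda>x. [:x:]) K) $$ (a, b)
        = (\<Sum>l<N. \<Sum>i\<le>d. monom (E i $$ (a, l) * K $$ (l, b)) i)"
    using a b K
    by (auto simp: polynomial_matrix_def scalar_prod_def smult_sum2 smult_monom
        mult.commute atLeast0LessThan intro!: sum.cong)
  also have "\<dots> = (\<Sum>i\<le>d. monom (\<Sum>l<N. E i $$ (a, l) * K $$ (l, b)) i)"
    by (subst sum.swap) (simp add: monom_sum)
  also have "\<dots> = polynomial_matrix k m d (\<lambda>i. E i * K) $$ (a, b)"
    using a b by (simp add: polynomial_matrix_def EK)
  finally show "(polynomial_matrix k N d E * map_mat (\<lambda>x. [:x:]) K) $$ (a, b)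
        = polynomial_matrix k m d (\<lambda>i. E i * K) $$ (a, b)" .
qed (use K in \<open>auto simp: polynomial_matrix_def\<close>)

lemma polynomial_matrix_const_one:
  fixes E :: "nat \<Rightarrow> 'a :: comm_ring_1 mat"
  assumes "E 0 = 1\<^sub>m k" and "\<And>i. 0 < i \<Longrightarrow> i \<le> d \<Longrightarrow> E i = 0\<^sub>m k k"
  shows "polynomial_matrix k k d E = 1\<^sub>m k"
proof (rule eq_matI)
  fix a b assume "a < dim_row (1\<^sub>m k :: 'a poly mat)" "b < dim_col (1\<^sub>m k :: 'a poly mat)"
  then have ab: "a < k" "b < k"
    by auto
  have "(\<Sum>i\<le>d. monom (E i $$ (a, b)) i) = (\<Sum>i\<in>{0}. monom (E i $$ (a, b)) i)"
    using assms(2) ab by (intro sum.mono_neutral_right) auto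
  then show "polynomial_matrix k k d E $$ (a, b) = 1\<^sub>m k $$ (a, b)"
    using assms(1) ab by (simp add: polynomial_matrix_def monom_0)
qed (auto simp: polynomial_matrix_def)

text \<open>The inner dimension \<open>w\<close> is not cut into blocks, so an entry of the product
  is a single scalar product of a row of one block with a column of another. \<open>Suc\<close>
  appears because blocks are numbered from 1.\<close>

lemma stack_mult_juxtapose_index:
  assumes "a < p * n" "b < q * n"
    and A: "A (Suc (a div n)) \<in> carrier_mat n w" and B: "B (Suc (b div n)) \<in> carrier_mat w n"
  shows "(stack_blocks p n w A * juxtapose_blocks q w n B) $$ (a, b)
         = (A (Suc (a div n)) * B (Suc (b div n))) $$ (a mod n, b mod n)"
proof -
  \<comment> \<open>This makes \<open>a mod n\<close> and \<open>b mod n\<close> valid indices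
    inside a block.\<close>
  have "0 < n"
    using assms(1) by (cases n) auto
  then show ?thesis
    using assms by (auto simp: stack_blocks_def juxtapose_blocks_def scalar_prod_def
        dest!: carrier_matD)
qed

text \<open>The product of two blocks is an \<open>n\<close> by \<open>n\<close> window of the big
  identity matrix, and this window is either on the diagonal or entirely off it.\<close>

lemma block_mult_of_inverse:
  fixes A B :: "nat \<Rightarrow> 'a :: semiring_1 mat"
  assumes inv: "stack_blocks s n w A * juxtapose_blocks s w n B = 1\<^sub>m (s * n)"
    and A: "\<And>j. j \<in> {1..s} \<Longrightarrow> A j \<in> carrier_mat n w"
    and B: "\<And>j. j \<in> {1..s} \<Longrightarrow> B j \<in> carrier_mat w n"
    and i: "i \<in> {1..s}" and j: "j \<in> {1..s}"
  shows "A i * B j = (if i = j then 1\<^sub>m n else 0\<^sub>m n n)"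
proof (rule eq_matI)
  fix p q
  assume "p < dim_row (if i = j then 1\<^sub>m n else 0\<^sub>m n n :: 'a mat)"
    and "q < dim_col (if i = j then 1\<^sub>m n else 0\<^sub>m n n :: 'a mat)"
  then have p: "p < n" and q: "q < n"
    by (auto split: if_splits)
  have bound: "(l - 1) * n + t < s * n" if "l \<in> {1..s}" "t < n" for l t
  proof -
    have "(l - 1) * n + t < (l - 1) * n + n"
      using that by simp
    also have "\<dots> = l * n"
      using that by (cases l) auto
    also have "\<dots> \<le> s * n"
      using that by simp
    finally show ?thesis .
  qed
  have "(A i * B j) $$ (p, q)
        = (stack_blocks s n w A * juxtapose_blocks s w n B) $$ ((i - 1) * n + p, (j - 1) * n + q)"
    using stack_mult_juxtapose_index[of "(i - 1) * n + p" s n "(j - 1) * n + q" s A w B]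
      bound[OF i p] bound[OF j q] A[OF i] B[OF j] i j p q by simp
  also have "\<dots> = (if (i - 1) * n + p = (j - 1) * n + q then 1 else 0)"
    using inv bound[OF i p] bound[OF j q] by simp
  \<comment> \<open>Since \<open>p\<close> and \<open>q\<close> are below \<open>n\<close>,
    uniqueness of quotient and remainder separates the block number from the position within the
    block.\<close>
  also have "(i - 1) * n + p = (j - 1) * n + q \<longleftrightarrow> i = j \<and> p = q"
  proof
    assume eq: "(i - 1) * n + p = (j - 1) * n + q"
    have "i - 1 = j - 1"
      using arg_cong[OF eq, of "\<lambda>x. x div n"] p q by simp
    moreover have "p = q"
      using arg_cong[OF eq, of "\<lambda>x. x mod n"] p q by simp
    ultimately show "i = j \<and> p = q"
      using i j by auto
  qed auto
  finally show "(A i * B j) $$ (p, q) = (if i = j then 1\<^sub>m n else 0\<^sub>m n n) $$ (p, q)"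
    using p q by auto
qed (use A[OF i] B[OF j] in auto)

theorem proposition6p1:
  fixes U V :: "'a :: field mat"
    and A B E :: "nat \<Rightarrow> 'a mat"
    and c :: "nat \<Rightarrow> nat \<Rightarrow> nat"
    and s n r :: nat
  assumes "U \<in> carrier_mat (s * n) (s * n)"
    and "V \<in> carrier_mat (s * n) (s * n)"
    and "U * V = 1\<^sub>m (s * n)"
    and "\<And>j. j \<in> {1..s} \<Longrightarrow> A j \<in> carrier_mat n (s * n)"
    and "\<And>j. j \<in> {1..s} \<Longrightarrow> B j \<in> carrier_mat (s * n) n"
    and "U = stack_blocks s n (s * n) A"
    and "V = juxtapose_blocks s (s * n) n B"
    and "\<And>i. i \<in> {0..s} \<Longrightarrow> c i ` {1..r} \<subseteq> {1..s}"
    and "\<And>i. i \<in> {0..s} \<Longrightarrow> inj_on (c i) {1..r}"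
    and "\<And>i. i \<in> {0..s} \<Longrightarrow> E i = stack_blocks r n (s * n) (\<lambda>t. A (c i t))"
    and "\<And>i j. j \<in> c 0 ` {1..r} \<Longrightarrow> i \<in> {0..s} \<Longrightarrow> i \<noteq> 0 \<Longrightarrow> j \<notin> c i ` {1..r}"
  defines "G \<equiv> polynomial_matrix (r * n) (s * n) s E"
  shows "\<exists>C. generator_matrix_for (s * n) (r * n) G C \<and> noncatastrophic G"
proof -
  define K where "K = juxtapose_blocks r (s * n) n (\<lambda>t. B (c 0 t))"
  \<comment> \<open>\<open>K\<close> serves the block computations over the field; \<open>H\<close>
    is the same matrix with entries read as constant polynomials, so that it can be multiplied with
    \<open>G\<close>.\<close>
  define H where "H = map_mat (\<lambda>x. [:x:]) K"
  have K: "K \<in> carrier_mat (s * n) (r * n)"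
    by (simp add: K_def juxtapose_blocks_def)
  have E: "E i \<in> carrier_mat (r * n) (s * n)" if "i \<le> s" for i
    using assms(10)[of i] that by (simp add: stack_blocks_def)
  have G: "G \<in> carrier_mat (r * n) (s * n)"
    by (simp add: G_def polynomial_matrix_def)
  have H: "H \<in> carrier_mat (s * n) (r * n)"
    using K by (simp add: H_def)
  note AB = block_mult_of_inverse[OF assms(3)[unfolded assms(6,7)] assms(4,5)]
  have c: "c i t \<in> {1..s}" if "i \<le> s" "t \<in> {1..r}" for i t
    using assms(8)[of i] that by (auto simp: image_subset_iff)
  have blk: "Suc (a div n) \<in> {1..r}" if "a < r * n" for a
    using that by (auto simp: less_mult_imp_div_less Suc_le_eq)
  \<comment> \<open>Each block of \<open>E i * K\<close> is the identity or zero, according to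
    whether the block chosen for \<open>E i\<close> and the one chosen for \<open>E 0\<close> have
    the same number. The cases \<open>i = 0\<close> and \<open>0 < i\<close> are both read off from
    this.\<close>
  have EK: "(E i * K) $$ (a, b)
      = (if c i (Suc (a div n)) = c 0 (Suc (b div n)) then 1\<^sub>m n else 0\<^sub>m n n) $$ (a mod n, b mod n)"
    if "i \<le> s" "a < r * n" "b < r * n" for i a b
  proof -
    have ca: "c i (Suc (a div n)) \<in> {1..s}" and cb: "c 0 (Suc (b div n)) \<in> {1..s}"
      using c blk that by auto
    show ?thesis
      using stack_mult_juxtapose_index[of a r n b r "\<lambda>t. A (c i t)" "s * n" "\<lambda>t. B (c 0 t)"]
        assms(4)[OF ca] assms(5)[OF cb] assms(10)[of i] AB[OF _ _ ca cb] that
      by (simp add: K_def)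
  qed
  have "E 0 * K = 1\<^sub>m (r * n)"
  proof (rule eq_matI)
    fix a b assume "a < dim_row (1\<^sub>m (r * n) :: 'a mat)" "b < dim_col (1\<^sub>m (r * n) :: 'a mat)"
    then have a: "a < r * n" and b: "b < r * n"
      by auto
    then have n: "0 < n"
      by (cases n) auto
    \<comment> \<open>Injectivity of the choice \<open>c 0\<close> is what makes the off-diagonal
      blocks of \<open>E 0 * K\<close> vanish.\<close>
    have "c 0 (Suc (a div n)) = c 0 (Suc (b div n)) \<longleftrightarrow> a div n = b div n"
      using inj_on_eq_iff[OF assms(9)[of 0] blk[OF a] blk[OF b]] by simp
    moreover have "a = b \<longleftrightarrow> a div n = b div n \<and> a mod n = b mod n"
      by (metis div_mult_mod_eq)
    ultimately show "(E 0 * K) $$ (a, b) = 1\<^sub>m (r * n) $$ (a, b)"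
      using EK[of 0 a b] a b n by auto
  qed (use E[of 0] K in auto)
  moreover have "E i * K = 0\<^sub>m (r * n) (r * n)" if i: "0 < i" "i \<le> s" for i
  proof (rule eq_matI)
    fix a b
    assume "a < dim_row (0\<^sub>m (r * n) (r * n) :: 'a mat)" "b < dim_col (0\<^sub>m (r * n) (r * n) :: 'a mat)"
    then have a: "a < r * n" and b: "b < r * n"
      by auto
    then have n: "0 < n"
      by (cases n) auto
    \<comment> \<open>A block used in \<open>E 0\<close> is barred from \<open>E i\<close>, so the
      two numbers never agree and every block of the product is zero.\<close>
    have "c i (Suc (a div n)) \<noteq> c 0 (Suc (b div n))"
      using assms(11)[of "c 0 (Suc (b div n))" i] blk[OF a] blk[OF b] i by force
    then show "(E i * K) $$ (a, b) = 0\<^sub>m (r * n) (r * n) $$ (a, b)"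
      using EK[of i a b] a b i n by simp
  qed (use E[of i] K i in auto)
  ultimately have GH: "G * H = 1\<^sub>m (r * n)"
    unfolding G_def H_def
    by (simp add: polynomial_matrix_mult_const[OF E K] polynomial_matrix_const_one)
  note rank = poly_mat_rank_right_inverse[OF G H GH]
  have "generator_matrix (s * n) (r * n) G"
    using G rank(1) by (simp add: generator_matrix_def)
  \<comment> \<open>The code is the one that \<open>G\<close> itself generates, so \<open>G\<close>
    also witnesses that it is convolutional.\<close>
  then have "generator_matrix_for (s * n) (r * n) G (code_of G)"
    by (auto simp: generator_matrix_for_def convolutional_code_def)
  moreover have "noncatastrophic G"
    unfolding noncatastrophic_def using G H GH rank(2) by auto
  ultimately show ?thesis
    by blast
qed

end
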